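(* Let $F$ be the free group on $\{x,y\}$. Each of the following presentations of the trivial group is AC-equivalent to $\langle x,y \mid x, y\rangle$: (a) $\langle x,y \mid x^2 = y^3,\ xyx=yxy\rangle$; (b) $\langle x,y \mid x^{-1}yx = y^2,\ x=yx^2yx^{-2}\rangle$; (c) $\langle x,y \mid x^{-1}y^2x = y^3,\ x^2=yxy^{-1}\rangle$; (d) $\langle x,y \mid x^{-1}y^2x = y^3,\ x^2=yxy\rangle$.
   Context: Let $F$ be a free group. For a tuple $Y=(y_1,\dots,y_m)$ of elements of $F$, consider the elementary transformations: (AC1) replace $y_i$ by $y_iy_j$ for some $j\ne i$; (AC2) replace $y_i$ by $y_i^{-1}$; (AC3) replace $y_i$ by $g y_i g^{-1}$ for some $g\in F$; in each case all other entries are unchanged. Two tuples are AC-equivalent (Andrews-Curtis equivalent) if one can be obtained from the other by a finite sequence of transformations (AC1)-(AC3). Two presentations on the same generators are AC-equivalent if their tuples of relators, viewed as elements of the free group on the generators, are AC-equivalent. A relation $u=v$ in a presentation stands for the relator $uv^{-1}$. *)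

theory Defs
  imports "HOL-Algebra.Elementary_Groups"
begin

text \<open>Free groups, as reduced words. The letter \<open>(s, True)\<close> stands for the generator
  \<open>s\<close> and \<open>(s, False)\<close> for its inverse.\<close>

type_synonym 'a letter = "'a \<times> bool"

definition inv_letter :: "'a letter \<Rightarrow> 'a letter" where
  "inv_letter a = (fst a, \<not> snd a)"

definition reduced :: "'a letter list \<Rightarrow> bool" where
  "reduced w \<longleftrightarrow> successively (\<lambda>a b. b \<noteq> inv_letter a) w"

fun cons_letter :: "'a letter \<Rightarrow> 'a letter list \<Rightarrow> 'a letter list" where
  "cons_letter a [] = [a]"
| "cons_letter a (b # w) = (if b = inv_letter a then w else a # b # w)"

definition free_group :: "'a set \<Rightarrow> 'a letter list monoid" where
  "free_group S =
    \<lparr>carrier = {w. fst ` set w \<subseteq> S \<and> reduced w},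
     mult = (\<lambda>u v. foldr cons_letter u v),
     one = []\<rparr>"

definition free_gen :: "'a \<Rightarrow> 'a letter list" where
  "free_gen s = [(s, True)]"

lemma inv_letter_inv_letter [simp]: "inv_letter (inv_letter a) = a"
  by (simp add: inv_letter_def)

lemma inv_letter_neq [simp]: "inv_letter a \<noteq> a" "a \<noteq> inv_letter a"
  by (auto simp: inv_letter_def prod_eq_iff)

lemma fst_inv_letter [simp]: "fst (inv_letter a) = fst a"
  by (simp add: inv_letter_def)

lemma reduced_Nil [simp]: "reduced []"
  by (simp add: reduced_def)

lemma reduced_Cons:
  "reduced (a # w) \<longleftrightarrow> reduced w \<and> (w = [] \<or> hd w \<noteq> inv_letter a)"
  by (cases w) (auto simp: reduced_def)

lemma reduced_cons_letter: "reduced w \<Longrightarrow> reduced (cons_letter a w)"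
  by (cases w) (auto simp: reduced_Cons)

lemma set_cons_letter: "set (cons_letter a w) \<subseteq> insert a (set w)"
  by (cases w) auto

lemma cons_letter_cancel:
  "reduced w \<Longrightarrow> cons_letter (inv_letter a) (cons_letter a w) = w"
  by (cases w; cases "tl w") (auto simp: reduced_Cons)

lemma reduced_foldr_cons_letter: "reduced v \<Longrightarrow> reduced (foldr cons_letter u v)"
  by (induction u) (auto intro: reduced_cons_letter)

lemma set_foldr_cons_letter: "set (foldr cons_letter u v) \<subseteq> set u \<union> set v"
  by (induction u) (use set_cons_letter in fastforce)+

lemma foldr_cons_letter_cons_letter:
  "reduced u \<Longrightarrow> reduced v \<Longrightarrow>
    foldr cons_letter (cons_letter a u) v = cons_letter a (foldr cons_letter u v)"
  using cons_letter_cancel[of "foldr cons_letter (tl u) v" "inv_letter a"]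
  by (cases u) (auto simp: reduced_Cons reduced_foldr_cons_letter)

lemma foldr_cons_letter_assoc:
  "reduced v \<Longrightarrow> reduced w \<Longrightarrow>
    foldr cons_letter (foldr cons_letter u v) w = foldr cons_letter u (foldr cons_letter v w)"
  by (induction u) (auto simp: foldr_cons_letter_cons_letter reduced_foldr_cons_letter)

lemma foldr_cons_letter_Nil: "reduced u \<Longrightarrow> foldr cons_letter u [] = u"
proof (induction u)
  case (Cons a u)
  then show ?case by (cases u) (auto simp: reduced_Cons)
qed simp

lemma foldr_cons_letter_left_inverse:
  "foldr cons_letter (rev (map inv_letter u)) (foldr cons_letter u []) = []"
  by (induction u) (simp_all add: cons_letter_cancel reduced_foldr_cons_letter)

lemma reduced_rev_map_inv_letter: "reduced (rev (map inv_letter w)) \<longleftrightarrow> reduced w"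
proof -
  have "(\<lambda>a b. inv_letter a \<noteq> inv_letter (inv_letter b)) = (\<lambda>a b. b \<noteq> inv_letter a)"
    by (intro ext) (metis inv_letter_inv_letter)
  then show ?thesis
    unfolding reduced_def successively_rev successively_map
    by (rule arg_cong[where f = "\<lambda>P. successively P w"])
qed

theorem group_free_group: "group (free_group S)"
proof (rule groupI)
  fix u v w
  assume u: "u \<in> carrier (free_group S)" and v: "v \<in> carrier (free_group S)"
  then show "u \<otimes>\<^bsub>free_group S\<^esub> v \<in> carrier (free_group S)"
    using set_foldr_cons_letter[of u v]
    by (fastforce simp: free_group_def reduced_foldr_cons_letter)
  assume "w \<in> carrier (free_group S)"
  with v show "u \<otimes>\<^bsub>free_group S\<^esub> v \<otimes>\<^bsub>free_group S\<^esub> w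
      = u \<otimes>\<^bsub>free_group S\<^esub> (v \<otimes>\<^bsub>free_group S\<^esub> w)"
    by (simp add: free_group_def foldr_cons_letter_assoc)
next
  fix u
  assume u: "u \<in> carrier (free_group S)"
  then have "rev (map inv_letter u) \<in> carrier (free_group S)"
    by (auto simp: free_group_def reduced_rev_map_inv_letter)
  moreover have "rev (map inv_letter u) \<otimes>\<^bsub>free_group S\<^esub> u = \<one>\<^bsub>free_group S\<^esub>"
    using u foldr_cons_letter_left_inverse[of u]
    by (simp add: free_group_def foldr_cons_letter_Nil)
  ultimately show "\<exists>v\<in>carrier (free_group S). v \<otimes>\<^bsub>free_group S\<^esub> u = \<one>\<^bsub>free_group S\<^esub>"
    by blast
qed (auto simp: free_group_def)

lemma free_gen_closed: "s \<in> S \<Longrightarrow> free_gen s \<in> carrier (free_group S)"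
  by (simp add: free_group_def free_gen_def reduced_Cons)

lemma inv_free_group:
  assumes "w \<in> carrier (free_group S)"
  shows "inv\<^bsub>free_group S\<^esub> w = rev (map inv_letter w)"
proof -
  have "rev (map inv_letter w) \<in> carrier (free_group S)"
    using assms by (auto simp: free_group_def reduced_rev_map_inv_letter)
  moreover have "rev (map inv_letter w) \<otimes>\<^bsub>free_group S\<^esub> w = \<one>\<^bsub>free_group S\<^esub>"
    using assms foldr_cons_letter_left_inverse[of w]
    by (simp add: free_group_def foldr_cons_letter_Nil)
  ultimately show ?thesis
    using assms group.inv_equality[OF group_free_group] by blast
qed


text \<open>Andrews-Curtis equivalence of tuples in a group.\<close>

inductive AC_step :: "('g, 'b) monoid_scheme \<Rightarrow> 'g list \<Rightarrow> 'g list \<Rightarrow> bool"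
  for G (structure) where
  AC1: "i < length Y \<Longrightarrow> j < length Y \<Longrightarrow> j \<noteq> i \<Longrightarrow> AC_step G Y (Y[i := Y ! i \<otimes> Y ! j])"
| AC2: "i < length Y \<Longrightarrow> AC_step G Y (Y[i := inv (Y ! i)])"
| AC3: "i < length Y \<Longrightarrow> g \<in> carrier G \<Longrightarrow> AC_step G Y (Y[i := g \<otimes> Y ! i \<otimes> inv g])"

definition AC_equivalent :: "('g, 'b) monoid_scheme \<Rightarrow> 'g list \<Rightarrow> 'g list \<Rightarrow> bool" where
  "AC_equivalent G = (AC_step G)\<^sup>*\<^sup>*"


text \<open>The relators are reduced words, i.e. elements of the free group on the generators.\<close>

datatype 'a presentation = Presentation (generators: "'a set") (relators: "'a letter list list")

definition AC_equivalent_presentations :: "'a presentation \<Rightarrow> 'a presentation \<Rightarrow> bool" where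
  "AC_equivalent_presentations P Q \<longleftrightarrow>
    generators P = generators Q \<and>
    AC_equivalent (free_group (generators P)) (relators P) (relators Q)"

definition normal_closure :: "('g, 'b) monoid_scheme \<Rightarrow> 'g set \<Rightarrow> 'g set" where
  "normal_closure G R =
    generate G {g \<otimes>\<^bsub>G\<^esub> r \<otimes>\<^bsub>G\<^esub> inv\<^bsub>G\<^esub> g | g r. g \<in> carrier G \<and> r \<in> R}"

definition presented_group :: "'a presentation \<Rightarrow> 'a letter list set monoid" where
  "presented_group P =
    free_group (generators P) Mod normal_closure (free_group (generators P)) (set (relators P))"

definition presents_trivial_group :: "'a presentation \<Rightarrow> bool" where
  "presents_trivial_group P \<longleftrightarrow> trivial_group (presented_group P)"

definition relator_of :: "('g, 'b) monoid_scheme \<Rightarrow> 'g \<Rightarrow> 'g \<Rightarrow> 'g" (infix \<open>\<doteq>\<index>\<close> 50) where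
  "u \<doteq>\<^bsub>G\<^esub> v = u \<otimes>\<^bsub>G\<^esub> inv\<^bsub>G\<^esub> v"

end

(* Combining AC1-AC3, an entry a of a pair (a, b) may be replaced by a conjugate of
   a (g b g^-1) or a (g b^-1 g^-1), so each presentation only needs a sequence of such
   replacements ending in generators. The sequences below were found by a breadth-first
   search over pairs of cyclic words of bounded total length. That the groups are trivial
   follows, since an AC step stays within any normal subgroup containing the tuple:
   the normal closure of the relators therefore contains x and y. *)
theory Submission
  imports Defs
begin

context group
begin

section \<open>Andrews-Curtis moves on pairs in an arbitrary group\<close>

lemma AC_equivalent_trans [trans]:
  "AC_equivalent G A B \<Longrightarrow> AC_equivalent G B C \<Longrightarrow> AC_equivalent G A C"
  unfolding AC_equivalent_def by (rule rtranclp_trans)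

lemma AC_equivalent_step: "AC_step G A B \<Longrightarrow> AC_equivalent G A B"
  unfolding AC_equivalent_def by (rule r_into_rtranclp)

lemma AC_equivalent_inv_fst: "AC_equivalent G [a, b] [inv a, b]"
  using AC_step.AC2[of 0 "[a, b]" G] by (simp add: AC_equivalent_step)

lemma AC_equivalent_inv_snd: "AC_equivalent G [a, b] [a, inv b]"
  using AC_step.AC2[of 1 "[a, b]" G] by (simp add: AC_equivalent_step)

lemma AC_equivalent_conj_fst:
  "g \<in> carrier G \<Longrightarrow> AC_equivalent G [a, b] [g \<otimes> a \<otimes> inv g, b]"
  using AC_step.AC3[of 0 "[a, b]" g G] by (simp add: AC_equivalent_step)

lemma AC_equivalent_conj_snd:
  "g \<in> carrier G \<Longrightarrow> AC_equivalent G [a, b] [a, g \<otimes> b \<otimes> inv g]"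
  using AC_step.AC3[of 1 "[a, b]" g G] by (simp add: AC_equivalent_step)

lemma AC_equivalent_mult_fst: "AC_equivalent G [a, b] [a \<otimes> b, b]"
  using AC_step.AC1[of 0 "[a, b]" 1 G] by (simp add: AC_equivalent_step)

lemma AC_equivalent_mult_snd: "AC_equivalent G [a, b] [a, b \<otimes> a]"
  using AC_step.AC1[of 1 "[a, b]" 0 G] by (simp add: AC_equivalent_step)

text \<open>In a right-nested product an inverse pair is usually followed by a tail. With these
  rules beside \<open>m_assoc\<close> and \<open>inv_mult_group\<close>, the simplifier performs
  free reduction, which settles every word identity below.\<close>

lemma inv_mult_cancel_left [simp]:
  "a \<in> carrier G \<Longrightarrow> b \<in> carrier G \<Longrightarrow> inv a \<otimes> (a \<otimes> b) = b"
  "a \<in> carrier G \<Longrightarrow> b \<in> carrier G \<Longrightarrow> a \<otimes> (inv a \<otimes> b) = b"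
  by (simp_all flip: m_assoc)

lemma relator_closed: "u \<in> carrier G \<Longrightarrow> v \<in> carrier G \<Longrightarrow> (u \<doteq> v) \<in> carrier G"
  by (simp add: relator_of_def)

text \<open>The analogue of exchanging two numbers by additions: the pair passes through
  \<open>[a \<otimes> b, b]\<close> and \<open>[a \<otimes> b, a]\<close>, with inversions supplying
  the subtractions.\<close>

lemma AC_equivalent_swap:
  assumes [simp]: "a \<in> carrier G" "b \<in> carrier G"
  shows "AC_equivalent G [a, b] [b, a]"
proof -
  have "AC_equivalent G [a, b] [a \<otimes> b, b]"
    by (rule AC_equivalent_mult_fst)
  also have "AC_equivalent G ... [a \<otimes> b, inv b]"
    by (rule AC_equivalent_inv_snd)
  also have "AC_equivalent G ... [a \<otimes> b, inv b \<otimes> (a \<otimes> b)]"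
    by (rule AC_equivalent_mult_snd)
  \<comment> \<open>AC1 multiplies on the right only, so the factor \<open>inv b\<close> stands on
    the left of the new entry; conjugation by \<open>b\<close> carries it to the right end, where it
    cancels.\<close>
  also have "AC_equivalent G ... [a \<otimes> b, b \<otimes> (inv b \<otimes> (a \<otimes> b)) \<otimes> inv b]"
    by (rule AC_equivalent_conj_snd) simp
  also have "... = [a \<otimes> b, a]"
    by (simp add: m_assoc inv_mult_group)
  also have "AC_equivalent G ... [inv (a \<otimes> b), a]"
    by (rule AC_equivalent_inv_fst)
  also have "AC_equivalent G ... [inv (a \<otimes> b) \<otimes> a, a]"
    by (rule AC_equivalent_mult_fst)
  also have "AC_equivalent G ... [inv (inv (a \<otimes> b) \<otimes> a), a]"
    by (rule AC_equivalent_inv_fst)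
  also have "... = [b, a]"
    by (simp add: m_assoc inv_mult_group)
  finally show ?thesis .
qed

text \<open>Conjugating the first entry by \<open>inv g\<close>, multiplying by \<open>b\<close> and
  conjugating back by \<open>g\<close> restores \<open>a\<close> and leaves \<open>b\<close>
  conjugated.\<close>

lemma AC_equivalent_mult_conj:
  assumes [simp]: "a \<in> carrier G" "b \<in> carrier G" "g \<in> carrier G"
  shows "AC_equivalent G [a, b] [a \<otimes> (g \<otimes> b \<otimes> inv g), b]"
proof -
  have "AC_equivalent G [a, b] [inv g \<otimes> a \<otimes> inv (inv g), b]"
    by (rule AC_equivalent_conj_fst) simp
  also have "AC_equivalent G ... [inv g \<otimes> a \<otimes> inv (inv g) \<otimes> b, b]"
    by (rule AC_equivalent_mult_fst)
  also have "AC_equivalent G ... [g \<otimes> (inv g \<otimes> a \<otimes> inv (inv g) \<otimes> b) \<otimes> inv g, b]"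
    by (rule AC_equivalent_conj_fst) simp
  also have "... = [a \<otimes> (g \<otimes> b \<otimes> inv g), b]"
    by (simp add: m_assoc inv_mult_group)
  finally show ?thesis .
qed

lemma AC_equivalent_mult_conj_inv:
  assumes [simp]: "a \<in> carrier G" "b \<in> carrier G" "g \<in> carrier G"
  shows "AC_equivalent G [a, b] [a \<otimes> (g \<otimes> inv b \<otimes> inv g), b]"
proof -
  have "AC_equivalent G [a, b] [a, inv b]"
    by (rule AC_equivalent_inv_snd)
  also have "AC_equivalent G ... [a \<otimes> (g \<otimes> inv b \<otimes> inv g), inv b]"
    by (rule AC_equivalent_mult_conj) simp_all
  also have "AC_equivalent G ... [a \<otimes> (g \<otimes> inv b \<otimes> inv g), inv (inv b)]"
    by (rule AC_equivalent_inv_snd)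
  finally show ?thesis by simp
qed

text \<open>The single replacement rule of the sequences below. Keeping \<open>c\<close> as a
  variable lets each step display the freely reduced result and leaves only a word identity; the
  disjunction lets the simplifier find the sign of \<open>b\<close>. The outer \<open>h\<close>
  permits cyclic rotation of the result.\<close>

lemma AC_equivalent_fst:
  assumes [simp]: "a \<in> carrier G" "b \<in> carrier G" "g \<in> carrier G" "h \<in> carrier G"
    and "c = h \<otimes> (a \<otimes> (g \<otimes> b \<otimes> inv g)) \<otimes> inv h \<or>
      c = h \<otimes> (a \<otimes> (g \<otimes> inv b \<otimes> inv g)) \<otimes> inv h"
  shows "AC_equivalent G [a, b] [c, b]"
  using assms(5)
proof
  assume "c = h \<otimes> (a \<otimes> (g \<otimes> b \<otimes> inv g)) \<otimes> inv h"
  then show ?thesis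
    using AC_equivalent_trans[OF AC_equivalent_mult_conj AC_equivalent_conj_fst] by simp
next
  assume "c = h \<otimes> (a \<otimes> (g \<otimes> inv b \<otimes> inv g)) \<otimes> inv h"
  then show ?thesis
    using AC_equivalent_trans[OF AC_equivalent_mult_conj_inv AC_equivalent_conj_fst] by simp
qed

lemma AC_equivalent_snd:
  assumes [simp]: "a \<in> carrier G" "b \<in> carrier G" "g \<in> carrier G" "h \<in> carrier G"
    and c: "c = h \<otimes> (b \<otimes> (g \<otimes> a \<otimes> inv g)) \<otimes> inv h \<or>
      c = h \<otimes> (b \<otimes> (g \<otimes> inv a \<otimes> inv g)) \<otimes> inv h"
  shows "AC_equivalent G [a, b] [a, c]"
proof -
  \<comment> \<open>The second swap needs closure of the new entry.\<close>
  have [simp]: "c \<in> carrier G"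
    using c by auto
  have "AC_equivalent G [a, b] [b, a]"
    by (rule AC_equivalent_swap) simp_all
  also have "AC_equivalent G ... [c, a]"
    using c by (intro AC_equivalent_fst[of b a g h]) simp_all
  also have "AC_equivalent G ... [a, c]"
    by (rule AC_equivalent_swap) simp_all
  finally show ?thesis .
qed

section \<open>Explicit replacement sequences for the four presentations\<close>

lemma AC_trivial_a:
  assumes [simp]: "x \<in> carrier G" "y \<in> carrier G"
  shows "AC_equivalent G
    [x [^] (2::nat) \<doteq> y [^] (3::nat),
     x \<otimes> y \<otimes> x \<doteq> y \<otimes> x \<otimes> y]
    [x, y]" (is "AC_equivalent G ?R _")
proof -
  let ?X = "inv x" and ?Y = "inv y"
  have relators: "?R =
     [x \<otimes> x \<otimes> ?Y \<otimes> ?Y \<otimes> ?Y, x \<otimes> y \<otimes> x \<otimes> ?Y \<otimes> ?X \<otimes> ?Y]"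
    by (simp add: relator_of_def numeral_2_eq_2 numeral_3_eq_3 int_pow_def2
        m_assoc inv_mult_group)
  have "AC_equivalent G
     [x \<otimes> x \<otimes> ?Y \<otimes> ?Y \<otimes> ?Y, x \<otimes> y \<otimes> x \<otimes> ?Y \<otimes> ?X \<otimes> ?Y]
      [x \<otimes> x \<otimes> ?Y \<otimes> ?Y \<otimes> ?Y, y \<otimes> ?X \<otimes> y \<otimes> y \<otimes> ?X \<otimes> ?Y \<otimes> x]"
    \<comment> \<open>In \<open>g\<close> the factor \<open>y \<otimes> x\<close> inverts the suffix
      \<open>?X \<otimes> ?Y\<close> of the second entry, and \<open>?Y \<otimes> ?Y\<close> rotates
      the inverse of the first. Thus
      \<open>y \<otimes> ?X \<otimes> ?X \<otimes> y \<otimes> y\<close> is spliced in before that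
      suffix; \<open>h\<close> then moves the leading \<open>x\<close> to the end.\<close>
    by (rule AC_equivalent_snd[where g = "y \<otimes> x \<otimes> ?Y \<otimes> ?Y" and h = "?X"])
      (simp_all add: m_assoc inv_mult_group)
  also have "AC_equivalent G ... [?Y \<otimes> x \<otimes> y \<otimes> ?X \<otimes> ?Y \<otimes> x,
      y \<otimes> ?X \<otimes> y \<otimes> y \<otimes> ?X \<otimes> ?Y \<otimes> x]"
    by (rule AC_equivalent_fst[where g = "y \<otimes> x \<otimes> ?Y" and h = "?X"])
      (simp_all add: m_assoc inv_mult_group)
  also have "AC_equivalent G ... [x \<otimes> ?Y \<otimes> ?Y \<otimes> x \<otimes> ?Y, y \<otimes> ?X \<otimes> y \<otimes> y \<otimes> ?X \<otimes> ?Y \<otimes> x]"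
    by (rule AC_equivalent_fst[where g = "\<one>" and h = "x \<otimes> ?Y"])
      (simp_all add: m_assoc inv_mult_group)
  \<comment> \<open>The first relator now identifies \<open>x\<close> with \<open>y\<close>, which
    collapses the second to a single letter.\<close>
  also have "AC_equivalent G ... [x \<otimes> ?Y, y \<otimes> ?X \<otimes> y \<otimes> y \<otimes> ?X \<otimes> ?Y \<otimes> x]"
    by (rule AC_equivalent_fst[where g = "\<one>" and h = "y"])
      (simp_all add: m_assoc inv_mult_group)
  also have "AC_equivalent G ... [x \<otimes> ?Y, y]"
    by (rule AC_equivalent_snd[where g = "?X \<otimes> y" and h = "\<one>"])
      (simp_all add: m_assoc inv_mult_group)
  also have "AC_equivalent G ... [x, y]"
    by (rule AC_equivalent_fst[where g = "\<one>" and h = "\<one>"])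
      (simp_all add: m_assoc inv_mult_group)
  finally show ?thesis
    unfolding relators .
qed

lemma AC_trivial_b:
  assumes [simp]: "x \<in> carrier G" "y \<in> carrier G"
  shows "AC_equivalent G
    [inv x \<otimes> y \<otimes> x \<doteq> y [^] (2::nat),
     x \<doteq> y \<otimes> x [^] (2::nat) \<otimes> y \<otimes> x [^] (-2::int)]
    [x, y]" (is "AC_equivalent G ?R _")
proof -
  let ?X = "inv x" and ?Y = "inv y"
  \<comment> \<open>Inverting the right-hand side turns its final \<open>x [^] (-2::int)\<close>
    into a leading square, which joins the \<open>x\<close> on the left to make a cube.\<close>
  have relators: "?R =
     [?X \<otimes> y \<otimes> x \<otimes> ?Y \<otimes> ?Y, x \<otimes> x \<otimes> x \<otimes> ?Y \<otimes> ?X \<otimes> ?X \<otimes> ?Y]"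
    by (simp add: relator_of_def numeral_2_eq_2 numeral_3_eq_3 int_pow_def2
        m_assoc inv_mult_group)
  have "AC_equivalent G
     [?X \<otimes> y \<otimes> x \<otimes> ?Y \<otimes> ?Y, x \<otimes> x \<otimes> x \<otimes> ?Y \<otimes> ?X \<otimes> ?X \<otimes> ?Y]
      [?X \<otimes> y \<otimes> x \<otimes> ?Y \<otimes> ?Y, ?Y \<otimes> x \<otimes> x \<otimes> ?Y \<otimes> ?X \<otimes> ?Y]"
    by (rule AC_equivalent_snd[where g = "x" and h = "?Y \<otimes> ?X"])
      (simp_all add: m_assoc inv_mult_group)
  also have "AC_equivalent G ... [?X \<otimes> y \<otimes> x \<otimes> ?Y \<otimes> ?Y, ?X \<otimes> ?Y \<otimes> x \<otimes> x \<otimes> ?Y \<otimes> ?Y \<otimes> ?Y]"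
    by (rule AC_equivalent_snd[where g = "x" and h = "?X"])
      (simp_all add: m_assoc inv_mult_group)
  also have "AC_equivalent G ... [?X \<otimes> y \<otimes> x \<otimes> ?Y \<otimes> ?Y, ?X \<otimes> ?Y \<otimes> x \<otimes> ?Y \<otimes> x \<otimes> ?Y]"
    by (rule AC_equivalent_snd[where g = "y" and h = "\<one>"])
      (simp_all add: m_assoc inv_mult_group)
  also have "AC_equivalent G ... [?X \<otimes> y \<otimes> x \<otimes> ?Y \<otimes> ?Y, x \<otimes> y \<otimes> ?X \<otimes> ?Y \<otimes> x \<otimes> ?Y \<otimes> ?Y]"
    by (rule AC_equivalent_snd[where g = "?Y" and h = "x \<otimes> y"])
      (simp_all add: m_assoc inv_mult_group)
  also have "AC_equivalent G ... [?Y \<otimes> x \<otimes> ?Y \<otimes> ?Y, x \<otimes> y \<otimes> ?X \<otimes> ?Y \<otimes> x \<otimes> ?Y \<otimes> ?Y]"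
    by (rule AC_equivalent_fst[where g = "y \<otimes> ?X" and h = "y"])
      (simp_all add: m_assoc inv_mult_group)
  also have "AC_equivalent G ... [?Y, x \<otimes> y \<otimes> ?X \<otimes> ?Y \<otimes> x \<otimes> ?Y \<otimes> ?Y]"
    by (rule AC_equivalent_fst[where g = "\<one>" and h = "?X"])
      (simp_all add: m_assoc inv_mult_group)
  \<comment> \<open>Once one entry is a generator up to inversion, a replacement can delete one
    occurrence of it anywhere in the other entry.\<close>
  also have "AC_equivalent G ... [?Y, x \<otimes> y \<otimes> ?X \<otimes> ?Y \<otimes> x \<otimes> ?Y]"
    by (rule AC_equivalent_snd[where g = "\<one>" and h = "\<one>"])
      (simp_all add: m_assoc inv_mult_group)
  also have "AC_equivalent G ... [?Y, x]"
    by (rule AC_equivalent_snd[where g = "y \<otimes> ?X" and h = "\<one>"])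
      (simp_all add: m_assoc inv_mult_group)
  also have "AC_equivalent G ... [y, x]"
    using AC_equivalent_inv_fst[of ?Y x] by simp
  also have "AC_equivalent G ... [x, y]"
    by (rule AC_equivalent_swap) simp_all
  finally show ?thesis
    unfolding relators .
qed

lemma AC_trivial_c:
  assumes [simp]: "x \<in> carrier G" "y \<in> carrier G"
  shows "AC_equivalent G
    [inv x \<otimes> y [^] (2::nat) \<otimes> x \<doteq> y [^] (3::nat),
     x [^] (2::nat) \<doteq> y \<otimes> x \<otimes> inv y]
    [x, y]" (is "AC_equivalent G ?R _")
proof -
  let ?X = "inv x" and ?Y = "inv y"
  have relators: "?R =
     [?X \<otimes> y \<otimes> y \<otimes> x \<otimes> ?Y \<otimes> ?Y \<otimes> ?Y, x \<otimes> x \<otimes> y \<otimes> ?X \<otimes> ?Y]"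
    by (simp add: relator_of_def numeral_2_eq_2 numeral_3_eq_3 int_pow_def2
        m_assoc inv_mult_group)
  have "AC_equivalent G
     [?X \<otimes> y \<otimes> y \<otimes> x \<otimes> ?Y \<otimes> ?Y \<otimes> ?Y, x \<otimes> x \<otimes> y \<otimes> ?X \<otimes> ?Y]
      [?Y \<otimes> ?X \<otimes> y \<otimes> x \<otimes> x \<otimes> ?Y, x \<otimes> x \<otimes> y \<otimes> ?X \<otimes> ?Y]"
    by (rule AC_equivalent_fst[where g = "y \<otimes> y \<otimes> ?X \<otimes> ?X" and h = "?Y"])
      (simp_all add: m_assoc inv_mult_group)
  also have "AC_equivalent G ... [?Y \<otimes> ?X \<otimes> y \<otimes> x \<otimes> ?Y \<otimes> x \<otimes> x, x \<otimes> x \<otimes> y \<otimes> ?X \<otimes> ?Y]"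
    by (rule AC_equivalent_fst[where g = "?X \<otimes> ?X" and h = "\<one>"])
      (simp_all add: m_assoc inv_mult_group)
  also have "AC_equivalent G ... [?Y \<otimes> ?X \<otimes> y \<otimes> x \<otimes> ?Y \<otimes> x \<otimes> x, x \<otimes> ?Y \<otimes> x \<otimes> x]"
    by (rule AC_equivalent_snd[where g = "x \<otimes> y" and h = "?X \<otimes> ?X \<otimes> ?X"])
      (simp_all add: m_assoc inv_mult_group)
  also have "AC_equivalent G ... [?Y \<otimes> ?X \<otimes> y \<otimes> x \<otimes> ?Y \<otimes> x \<otimes> x, x]"
    by (rule AC_equivalent_snd[where g = "\<one>" and h = "y"])
      (simp_all add: m_assoc inv_mult_group)
  also have "AC_equivalent G ... [?Y \<otimes> ?X \<otimes> y \<otimes> x \<otimes> ?Y \<otimes> x, x]"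
    by (rule AC_equivalent_fst[where g = "\<one>" and h = "\<one>"])
      (simp_all add: m_assoc inv_mult_group)
  \<comment> \<open>Inserting \<open>?X\<close> before the suffix \<open>?Y \<otimes> x\<close>
    deletes the middle \<open>x\<close>; the rest collapses by free reduction.\<close>
  also have "AC_equivalent G ... [?Y, x]"
    by (rule AC_equivalent_fst[where g = "?X \<otimes> y" and h = "\<one>"])
      (simp_all add: m_assoc inv_mult_group)
  also have "AC_equivalent G ... [y, x]"
    using AC_equivalent_inv_fst[of ?Y x] by simp
  also have "AC_equivalent G ... [x, y]"
    by (rule AC_equivalent_swap) simp_all
  finally show ?thesis
    unfolding relators .
qed

lemma AC_trivial_d:
  assumes [simp]: "x \<in> carrier G" "y \<in> carrier G"
  shows "AC_equivalent G
    [inv x \<otimes> y [^] (2::nat) \<otimes> x \<doteq> y [^] (3::nat),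
     x [^] (2::nat) \<doteq> y \<otimes> x \<otimes> y]
    [x, y]" (is "AC_equivalent G ?R _")
proof -
  let ?X = "inv x" and ?Y = "inv y"
  have relators: "?R =
     [?X \<otimes> y \<otimes> y \<otimes> x \<otimes> ?Y \<otimes> ?Y \<otimes> ?Y, x \<otimes> x \<otimes> ?Y \<otimes> ?X \<otimes> ?Y]"
    by (simp add: relator_of_def numeral_2_eq_2 numeral_3_eq_3 int_pow_def2
        m_assoc inv_mult_group)
  have "AC_equivalent G
     [?X \<otimes> y \<otimes> y \<otimes> x \<otimes> ?Y \<otimes> ?Y \<otimes> ?Y, x \<otimes> x \<otimes> ?Y \<otimes> ?X \<otimes> ?Y]
      [?X \<otimes> y \<otimes> y \<otimes> x \<otimes> ?Y \<otimes> ?Y \<otimes> ?Y,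
      ?Y \<otimes> ?Y \<otimes> x \<otimes> y \<otimes> y \<otimes> ?X \<otimes> ?Y \<otimes> x]"
    by (rule AC_equivalent_snd[where g = "y \<otimes> x \<otimes> ?Y \<otimes> ?Y" and h = "?X"])
      (simp_all add: m_assoc inv_mult_group)
  also have "AC_equivalent G ... [?X \<otimes> y \<otimes> x \<otimes> ?Y \<otimes> ?Y \<otimes> x \<otimes> ?Y,
      ?Y \<otimes> ?Y \<otimes> x \<otimes> y \<otimes> y \<otimes> ?X \<otimes> ?Y \<otimes> x]"
    by (rule AC_equivalent_fst[where g = "y \<otimes> ?X \<otimes> y \<otimes> y" and h = "\<one>"])
      (simp_all add: m_assoc inv_mult_group)
  \<comment> \<open>The new second entry is a cyclic rotation of
    \<open>x \<otimes> x \<otimes> ?Y \<otimes> ?Y \<otimes> ?Y\<close>, the first relator of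
    (a).\<close>
  also have "AC_equivalent G ... [?X \<otimes> y \<otimes> x \<otimes> ?Y \<otimes> ?Y \<otimes> x \<otimes> ?Y, x \<otimes> ?Y \<otimes> ?Y \<otimes> ?Y \<otimes> x]"
    by (rule AC_equivalent_snd[where g = "\<one>" and h = "x \<otimes> ?Y"])
      (simp_all add: m_assoc inv_mult_group)
  \<comment> \<open>The second entry must grow here: its length goes from 5 to 8, then back to 5 and
    down to 2.\<close>
  also have "AC_equivalent G ... [?X \<otimes> y \<otimes> x \<otimes> ?Y \<otimes> ?Y \<otimes> x \<otimes> ?Y,
      x \<otimes> ?Y \<otimes> x \<otimes> ?Y \<otimes> ?Y \<otimes> x \<otimes> ?Y \<otimes> ?Y]"
    by (rule AC_equivalent_snd[where g = "\<one>" and h = "x \<otimes> ?Y"])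
      (simp_all add: m_assoc inv_mult_group)
  also have "AC_equivalent G ... [?X \<otimes> y \<otimes> x \<otimes> ?Y \<otimes> ?Y \<otimes> x \<otimes> ?Y, x \<otimes> ?Y \<otimes> ?Y \<otimes> x \<otimes> ?Y]"
    by (rule AC_equivalent_snd[where g = "y" and h = "\<one>"])
      (simp_all add: m_assoc inv_mult_group)
  also have "AC_equivalent G ... [?X \<otimes> y \<otimes> x \<otimes> ?Y \<otimes> ?Y \<otimes> x \<otimes> ?Y, x \<otimes> ?Y]"
    by (rule AC_equivalent_snd[where g = "\<one>" and h = "y"])
      (simp_all add: m_assoc inv_mult_group)
  also have "AC_equivalent G ... [?Y, x \<otimes> ?Y]"
    by (rule AC_equivalent_fst[where g = "y \<otimes> ?X \<otimes> y" and h = "\<one>"])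
      (simp_all add: m_assoc inv_mult_group)
  also have "AC_equivalent G ... [?Y, x]"
    by (rule AC_equivalent_snd[where g = "\<one>" and h = "\<one>"])
      (simp_all add: m_assoc inv_mult_group)
  also have "AC_equivalent G ... [y, x]"
    using AC_equivalent_inv_fst[of ?Y x] by simp
  also have "AC_equivalent G ... [x, y]"
    by (rule AC_equivalent_swap) simp_all
  finally show ?thesis
    unfolding relators .
qed

section \<open>Triviality of the presented groups\<close>

lemma AC_step_subset:
  assumes "AC_step G A B" "set A \<subseteq> N" "N \<lhd> G"
  shows "set B \<subseteq> N"
proof -
  interpret N: normal N G
    by fact
  have "A ! i \<in> N" if "i < length A" for i
    using that assms(2) nth_mem by blast
  with assms(1,2) show ?thesis
    \<comment> \<open>Only the changed entry matters: it is a product, an inverse or a conjugate of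
      elements of \<open>N\<close>, and the conjugate is where normality enters.\<close>
    by cases (auto dest!: set_update_subset_insert[THEN subsetD] intro: N.inv_op_closed2)
qed

lemma AC_equivalent_subset:
  assumes "AC_equivalent G A B" "set A \<subseteq> N" "N \<lhd> G"
  shows "set B \<subseteq> N"
  using assms(1,2) unfolding AC_equivalent_def
  by (induction rule: rtranclp_induct) (use AC_step_subset assms(3) in blast)+

text \<open>The generating set is itself closed under conjugation, since conjugating by
  \<open>g\<close> turns the conjugator \<open>k\<close> into \<open>g \<otimes> k\<close>.\<close>

lemma normal_closure_normal:
  assumes "R \<subseteq> carrier G"
  shows "normal_closure G R \<lhd> G"
  unfolding normal_closure_def
proof (rule normal_generateI)
  fix h g
  assume "h \<in> {g \<otimes> r \<otimes> inv g |g r. g \<in> carrier G \<and> r \<in> R}" and g: "g \<in> carrier G"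
  then obtain k r where k: "h = k \<otimes> r \<otimes> inv k" "k \<in> carrier G" "r \<in> R"
    by blast
  with assms g have "g \<otimes> h \<otimes> inv g = (g \<otimes> k) \<otimes> r \<otimes> inv (g \<otimes> k)"
    by (auto simp: m_assoc inv_mult_group)
  with k g show "g \<otimes> h \<otimes> inv g \<in> {g \<otimes> r \<otimes> inv g |g r. g \<in> carrier G \<and> r \<in> R}"
    by blast
qed (use assms in auto)

lemma subset_normal_closure:
  assumes "R \<subseteq> carrier G"
  shows "R \<subseteq> normal_closure G R"
proof
  fix r
  assume "r \<in> R"
  with assms have "r = \<one> \<otimes> r \<otimes> inv \<one>"
    by auto
  with \<open>r \<in> R\<close> show "r \<in> normal_closure G R"
    unfolding normal_closure_def by (blast intro: generate.incl)
qed

end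

text \<open>A reduced word is the product of its letters, each a generator or the inverse of one, so
  induction on the word applies.\<close>

lemma free_group_generators_subset:
  assumes "subgroup H (free_group S)" "free_gen ` S \<subseteq> H"
  shows "carrier (free_group S) \<subseteq> H"
proof
  interpret F: group "free_group S"
    by (rule group_free_group)
  interpret H: subgroup H "free_group S"
    by fact
  fix w
  assume "w \<in> carrier (free_group S)"
  then show "w \<in> H"
  proof (induction w)
    case Nil
    then show ?case
      using H.one_closed by (simp add: free_group_def)
  next
    case (Cons a w)
    obtain s b where a: "a = (s, b)"
      by fastforce
    with Cons.prems have s: "s \<in> S" and w: "w \<in> carrier (free_group S)"
      by (auto simp: free_group_def reduced_Cons)
    have gen: "free_gen s \<in> H"
      using s assms(2) by blast
    have "[a] = (if b then free_gen s else inv\<^bsub>free_group S\<^esub> free_gen s)"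
      using inv_free_group[OF free_gen_closed, OF s] by (simp add: a free_gen_def inv_letter_def)
    with gen have "[a] \<in> H"
      by auto
    moreover have "w \<in> H"
      using Cons.IH w by blast
    \<comment> \<open>Since \<open>a # w\<close> is reduced, \<open>cons_letter\<close> cancels
      nothing, and prepending a letter is multiplication in the group.\<close>
    moreover have "a # w = [a] \<otimes>\<^bsub>free_group S\<^esub> w"
      using Cons.prems by (cases w) (auto simp: free_group_def reduced_Cons)
    ultimately show ?case
      using H.m_closed by metis
  qed
qed

lemma presents_trivial_groupI:
  assumes "AC_equivalent (free_group S) R Q" "set R \<subseteq> carrier (free_group S)"
    and "free_gen ` S \<subseteq> set Q"
  shows "presents_trivial_group (Presentation S R)"
proof -
  interpret F: group "free_group S"
    by (rule group_free_group)
  let ?N = "normal_closure (free_group S) (set R)"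
  interpret N: normal ?N "free_group S"
    using assms(2) by (rule F.normal_closure_normal)
  have "set Q \<subseteq> ?N"
    using F.AC_equivalent_subset assms(1) F.subset_normal_closure[OF assms(2)] N.normal_axioms
    by blast
  then have "?N = carrier (free_group S)"
    using free_group_generators_subset[OF N.subgroup_axioms] assms(3) N.subset by blast
  \<comment> \<open>Every coset of the whole group is the whole group, so the quotient has a single
    element.\<close>
  moreover have "carrier (free_group S Mod carrier (free_group S)) \<subseteq> {carrier (free_group S)}"
    by (auto simp: FactGroup_def RCOSETS_def F.coset_join2[OF _ F.subgroup_self])
  ultimately show ?thesis
    using group.trivial_group_alt[OF N.factorgroup_is_group]
    by (auto simp: presents_trivial_group_def presented_group_def)
qed

theorem proposition1p1:
  fixes s t :: 'a and F (structure) and x y :: "'a letter list"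
  assumes "s \<noteq> t"
    and "F = free_group {s, t}"
    and "x = free_gen s" and "y = free_gen t"
  shows
    "\<forall>P \<in> {
      \<comment> \<open>(a)\<close>
      Presentation {s, t}
        [x [^] (2::nat) \<doteq> y [^] (3::nat),
         x \<otimes> y \<otimes> x \<doteq> y \<otimes> x \<otimes> y],
      \<comment> \<open>(b)\<close>
      Presentation {s, t}
        [inv x \<otimes> y \<otimes> x \<doteq> y [^] (2::nat),
         x \<doteq> y \<otimes> x [^] (2::nat) \<otimes> y \<otimes> x [^] (-2::int)],
      \<comment> \<open>(c)\<close>
      Presentation {s, t}
        [inv x \<otimes> y [^] (2::nat) \<otimes> x \<doteq> y [^] (3::nat),
         x [^] (2::nat) \<doteq> y \<otimes> x \<otimes> inv y],
      \<comment> \<open>(d)\<close>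
      Presentation {s, t}
        [inv x \<otimes> y [^] (2::nat) \<otimes> x \<doteq> y [^] (3::nat),
         x [^] (2::nat) \<doteq> y \<otimes> x \<otimes> y]}.
      presents_trivial_group P \<and>
      AC_equivalent_presentations P (Presentation {s, t} [x, y])"
proof -
  interpret group F
    unfolding \<open>F = free_group {s, t}\<close> by (rule group_free_group)
  have [simp]: "x \<in> carrier F" "y \<in> carrier F"
    by (simp_all add: assms free_gen_closed)
  \<comment> \<open>An AC-equivalence with \<open>[x, y]\<close> yields both conjuncts, because
    \<open>x\<close> and \<open>y\<close> are the free generators; the four sequences then finish
    the proof.\<close>
  have "presents_trivial_group (Presentation {s, t} R)"
    and "AC_equivalent_presentations (Presentation {s, t} R) (Presentation {s, t} [x, y])"
    if "AC_equivalent F R [x, y]" "set R \<subseteq> carrier F" for R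
    using that presents_trivial_groupI[of "{s, t}" R "[x, y]"]
    by (simp_all add: assms AC_equivalent_presentations_def)
  then show ?thesis
    by (simp add: relator_closed AC_trivial_a AC_trivial_b AC_trivial_c AC_trivial_d)
qed

end
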